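(* Let $A$ be a graded superring, $B$ a graded subring, $\alpha$ an automorphism of $A$, $\beta$ an automorphism of $B$, $\lambda\in\Lambda$, $\pi\in\mathbb{Z}_2$. If $\Psi\colon{}_BA_A\to\mathrm{HOM}^{\mathrm R}_B({}^{\alpha^{-1}}_{A}A^{\beta^{-1}}_{B},\{\lambda,\pi\}{}_BB_B)$ is an isomorphism of $(B,A)$-bimodules, then the map $\mathrm{tr}^{\mathrm R}:=\Psi(1_A)\colon{}^{\alpha^{-1}}_{B}A^{\beta^{-1}}_{B}\to\{\lambda,\pi\}{}_BB_B$ is a homomorphism of $(B,B)$-bimodules satisfying: (R3) if $\mathrm{tr}^{\mathrm R}(aA)=0$ for some $a\in A$, then $a=0$; (R4) for every $\varphi\in\mathrm{HOM}^{\mathrm R}_B(A^{\beta^{-1}}_{B},B_B)$ there exists an $a\in A$ such that $\varphi=\mathrm{tr}^{\mathrm R}\circ{}^{\ell}a$ (equality of maps of underlying abelian groups $A\to B$). Conversely, if there is a homomorphism of $(B,B)$-bimodules $\mathrm{tr}^{\mathrm R}\colon{}^{\alpha^{-1}}_{B}A^{\beta^{-1}}_{B}\to\{\lambda,\pi\}{}_BB_B$ satisfying (R3) and (R4), then $\mathrm{tr}^{\mathrm R}=\Psi(1_A)$ for some isomorphism of $(B,A)$-bimodules $\Psi\colon{}_BA_A\to\mathrm{HOM}^{\mathrm R}_B({}^{\alpha^{-1}}_{A}A^{\beta^{-1}}_{B},\{\lambda,\pi\}{}_BB_B)$.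
   Context: Fix an abelian group $\Lambda$. A graded superring is an associative unital $\Lambda\times\mathbb{Z}_2$-graded ring; subrings are graded (with the same unit), automorphisms preserve the grading, and modules and bimodules are $\Lambda\times\mathbb{Z}_2$-graded. For homogeneous $v$, $|v|\in\Lambda$ and $\bar v\in\mathbb{Z}_2$ denote its degrees; formulas involving degrees are stated for homogeneous elements and extended additively. Homomorphisms of modules and bimodules are additive maps of degree $(0,0)$ commuting strictly with the actions. Shifts: $\{\mu,\gamma\}M$ is $M$ as an abelian group, with $(\{\mu,\gamma\}M)_{\nu,\delta}=M_{\nu-\mu,\delta+\gamma}$, unchanged right action, and left action $a\cdot\{\mu,\gamma\}m=(-1)^{\gamma\bar a}\{\mu,\gamma\}(am)$. Twists: ${}^{\alpha^{-1}}_{A}A^{\beta^{-1}}_{B}$ is $A$ as a graded abelian group with $a\cdot x=\alpha^{-1}(a)x$ ($a\in A$) and $x\cdot b=x\beta^{-1}(b)$ ($b\in B$); ${}^{\alpha^{-1}}_{B}A^{\beta^{-1}}_{B}$ and $A^{\beta^{-1}}_{B}$ are obtained by restricting, resp. forgetting, the left action. ${}_BA_A$, ${}_BB_B$ carry the multiplication actions. For $a\in A$, ${}^{\ell}a\colon A\to A$ is ${}^{\ell}a(x)=ax$ (ordinary multiplication in $A$). For a right $B$-module $N$, $\mathrm{HOM}^{\mathrm R}_B(A^{\beta^{-1}}_{B},N)$ is the direct sum over $(\mu,\gamma)\in\Lambda\times\mathbb{Z}_2$ of the groups of additive maps $f\colon A\to N$ of degree $(\mu,\gamma)$ with $f(x\beta^{-1}(b))=f(x)b$.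 $\mathrm{HOM}^{\mathrm R}_B({}^{\alpha^{-1}}_{A}A^{\beta^{-1}}_{B},\{\lambda,\pi\}{}_BB_B)$ is a $(B,A)$-bimodule via $(b\cdot f)(x)=b\cdot f(x)$ (left action in $\{\lambda,\pi\}B$) and $(f\cdot a)(x)=f(\alpha^{-1}(a)x)$. *)

theory Defs
  imports "HOL-Algebra.QuotRing" "HOL-Algebra.Subrings" "HOL-Library.Z2" "HOL-Library.Product_Plus"
begin

text \<open>
  The grading group is the type \<open>'l \<times> bit\<close> with componentwise addition: \<open>'l\<close> is the
  abelian group \<open>\<Lambda>\<close> and \<open>bit\<close> is \<open>\<int>\<^sub>2\<close>.

  As in the record \<open>module\<close> of HOL-Algebra, additive groups are carried by ring records whose
  fields \<open>mult\<close> and \<open>one\<close> are irrelevant unless the structure is a ring.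
\<close>

record ('l, 'm) graded = "'m ring" +
  hcomp :: "'l \<times> bit \<Rightarrow> 'm set"

record ('l, 'm, 's) right_module = "('l, 'm) graded" +
  ract :: "'m \<Rightarrow> 's \<Rightarrow> 'm"

record ('l, 'm, 's, 'r) bimodule = "('l, 'm, 's) right_module" +
  lact :: "'r \<Rightarrow> 'm \<Rightarrow> 'm"


section \<open>Graded superrings\<close>

definition hdecomp ::
  "('l, 'm, 'z) graded_scheme \<Rightarrow> 'm \<Rightarrow> ('l \<times> bit \<Rightarrow> 'm) \<Rightarrow> bool"
  where "hdecomp M x c \<longleftrightarrow>
    (\<forall>d. c d \<in> hcomp M d) \<and>
    finite {d. c d \<noteq> \<zero>\<^bsub>M\<^esub>} \<and>
    x = (\<Oplus>\<^bsub>M\<^esub>d\<in>{d. c d \<noteq> \<zero>\<^bsub>M\<^esub>}. c d)"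

definition hpart :: "('l, 'm, 'z) graded_scheme \<Rightarrow> 'm \<Rightarrow> 'l \<times> bit \<Rightarrow> 'm"
  where "hpart M x = (THE c. hdecomp M x c)"

text \<open>The last assumption says that the group is the direct sum of its homogeneous components.\<close>

locale graded_group = abelian_group M
  for M :: "('l, 'm, 'z) graded_scheme" (structure) +
  assumes hcomp_subgroup: "additive_subgroup (hcomp M d) M"
    and hdecomp_unique: "x \<in> carrier M \<Longrightarrow> \<exists>!c. hdecomp M x c"

text \<open>That the unit has degree \<open>0\<close> follows and is not assumed. The zero ring is allowed.\<close>

locale graded_superring = ring A + graded_group A
  for A :: "('l::ab_group_add, 'a, 'z) graded_scheme" (structure) +
  assumes hcomp_mult:
    "\<lbrakk> x \<in> hcomp A d; y \<in> hcomp A e \<rbrakk> \<Longrightarrow> x \<otimes> y \<in> hcomp A (d + e)"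

definition graded_subring :: "'a set \<Rightarrow> ('l, 'a, 'z) graded_scheme \<Rightarrow> bool"
  where "graded_subring B A \<longleftrightarrow> subring B A \<and> (\<forall>b\<in>B. \<forall>d. hpart A b d \<in> B)"

definition sub_ring ::
  "('l, 'a, 'z) graded_scheme \<Rightarrow> 'a set \<Rightarrow> ('l, 'a, 'z) graded_scheme"
  where "sub_ring A B = A\<lparr>carrier := B, hcomp := (\<lambda>d. hcomp A d \<inter> B)\<rparr>"

definition graded_aut :: "('l, 'a, 'z) graded_scheme \<Rightarrow> ('a \<Rightarrow> 'a) set"
  where "graded_aut A = {h \<in> ring_iso A A. \<forall>d. \<forall>x\<in>hcomp A d. h x \<in> hcomp A d}"


section \<open>Twists and shifts\<close>

text \<open>
  \<open>twisted \<sigma> A \<tau>\<close> is \<open>A\<close> with \<open>a \<cdot> x = \<sigma>(a) x\<close> and \<open>x \<cdot> b = x \<tau>(b)\<close>. The rings that act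
  are not part of the record, so restricting the scalars to a subring does not change it; the rings
  are arguments of the notions of homomorphism below.
\<close>

definition twisted ::
  "('a \<Rightarrow> 'a) \<Rightarrow> ('l, 'a, 'z) graded_scheme \<Rightarrow> ('a \<Rightarrow> 'a) \<Rightarrow> ('l, 'a, 'a, 'a) bimodule"
  where "twisted \<sigma> A \<tau> =
    \<lparr>carrier = carrier A, mult = mult A, one = one A, zero = zero A, add = add A,
     hcomp = hcomp A,
     ract = (\<lambda>x b. x \<otimes>\<^bsub>A\<^esub> \<tau> b),
     lact = (\<lambda>a x. \<sigma> a \<otimes>\<^bsub>A\<^esub> x)\<rparr>"

definition regular :: "('l, 'a, 'z) graded_scheme \<Rightarrow> ('l, 'a, 'a, 'a) bimodule"
  where "regular A = twisted (\<lambda>a. a) A (\<lambda>a. a)"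

text \<open>
  The left action of \<open>{\<mu>,\<gamma>}M\<close>, given for homogeneous \<open>a\<close> by multiplying \<open>a \<cdot> m\<close> with
  \<open>(-1)\<close> to the power \<open>\<gamma>\<close> times the parity of \<open>a\<close>, is extended additively through the
  homogeneous parts of \<open>a\<close> in the ring \<open>R\<close> acting on the left.
\<close>

definition shift ::
  "('l::ab_group_add, 'r, 'y) graded_scheme \<Rightarrow> 'l \<Rightarrow> bit
    \<Rightarrow> ('l, 'm, 's, 'r, 'z) bimodule_scheme \<Rightarrow> ('l, 'm, 's, 'r, 'z) bimodule_scheme"
  where "shift R \<mu> \<gamma> M = M
    \<lparr>hcomp := (\<lambda>(\<nu>, \<delta>). hcomp M (\<nu> - \<mu>, \<delta> + \<gamma>)),
     lact := (\<lambda>a m. \<Oplus>\<^bsub>M\<^esub>d\<in>{d. hpart R a d \<noteq> \<zero>\<^bsub>R\<^esub>}.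
       if \<gamma> * snd d = 1 then \<ominus>\<^bsub>M\<^esub> lact M (hpart R a d) m else lact M (hpart R a d) m)\<rparr>"


section \<open>Homomorphisms\<close>

definition bimodule_hom ::
  "('l, 'r, 'u) graded_scheme \<Rightarrow> ('l, 's, 'v) graded_scheme
    \<Rightarrow> ('l, 'm, 's, 'r, 'y) bimodule_scheme \<Rightarrow> ('l, 'n, 's, 'r, 'z) bimodule_scheme
    \<Rightarrow> ('m \<Rightarrow> 'n) set"
  where "bimodule_hom R S M N =
    {f \<in> hom (add_monoid M) (add_monoid N).
      (\<forall>d. \<forall>x\<in>hcomp M d. f x \<in> hcomp N d) \<and>
      (\<forall>r\<in>carrier R. \<forall>x\<in>carrier M. f (lact M r x) = lact N r (f x)) \<and>
      (\<forall>x\<in>carrier M. \<forall>s\<in>carrier S. f (ract M x s) = ract N (f x) s)}"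

definition bimodule_iso ::
  "('l, 'r, 'u) graded_scheme \<Rightarrow> ('l, 's, 'v) graded_scheme
    \<Rightarrow> ('l, 'm, 's, 'r, 'y) bimodule_scheme \<Rightarrow> ('l, 'n, 's, 'r, 'z) bimodule_scheme
    \<Rightarrow> ('m \<Rightarrow> 'n) set"
  where "bimodule_iso R S M N =
    {f \<in> bimodule_hom R S M N. bij_betw f (carrier M) (carrier N)}"

text \<open>
  Maps between carriers are represented by functions extensional on the domain, so that equality of
  elements of the HOM groups is equality of maps.
\<close>

definition HOMR_comp ::
  "('l::ab_group_add, 's, 'u) graded_scheme
    \<Rightarrow> ('l, 'm, 's, 'y) right_module_scheme \<Rightarrow> ('l, 'n, 's, 'z) right_module_scheme
    \<Rightarrow> 'l \<times> bit \<Rightarrow> ('m \<Rightarrow> 'n) set"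
  where "HOMR_comp S M N d =
    {f \<in> hom (add_monoid M) (add_monoid N) \<inter> extensional (carrier M).
      (\<forall>e. \<forall>x\<in>hcomp M e. f x \<in> hcomp N (e + d)) \<and>
      (\<forall>x\<in>carrier M. \<forall>s\<in>carrier S. f (ract M x s) = ract N (f x) s)}"

text \<open>
  Homogeneous maps of pairwise distinct degrees are additively independent, so the direct sum of the
  homogeneous components is realized as the group of all finite sums of homogeneous maps. Being
  defined for right modules with further record fields, \<open>HOMR\<close> applies to a bimodule by forgetting
  its left action.
\<close>

definition HOMR ::
  "('l::ab_group_add, 's, 'u) graded_scheme
    \<Rightarrow> ('l, 'm, 's, 'y) right_module_scheme \<Rightarrow> ('l, 'n, 's, 'z) right_module_scheme
    \<Rightarrow> ('l, 'm \<Rightarrow> 'n) graded"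
  where "HOMR S M N =
    \<lparr>carrier = {(\<lambda>x\<in>carrier M. \<Oplus>\<^bsub>N\<^esub>d\<in>D. F d x) | D F.
       finite D \<and> (\<forall>d\<in>D. F d \<in> HOMR_comp S M N d)},
     mult = undefined, one = undefined,
     zero = (\<lambda>x\<in>carrier M. \<zero>\<^bsub>N\<^esub>),
     add = (\<lambda>f g. \<lambda>x\<in>carrier M. f x \<oplus>\<^bsub>N\<^esub> g x),
     hcomp = HOMR_comp S M N\<rparr>"

definition HOMR_bimodule ::
  "('l::ab_group_add, 's, 'u) graded_scheme
    \<Rightarrow> ('l, 'm, 's, 'p, 'y) bimodule_scheme \<Rightarrow> ('l, 'n, 's, 'q, 'z) bimodule_scheme
    \<Rightarrow> ('l, 'm \<Rightarrow> 'n, 'p, 'q) bimodule"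
  where "HOMR_bimodule S M N =
    \<lparr>carrier = carrier (HOMR S M N), mult = mult (HOMR S M N), one = one (HOMR S M N),
     zero = zero (HOMR S M N), add = add (HOMR S M N), hcomp = hcomp (HOMR S M N),
     ract = (\<lambda>f a. \<lambda>x\<in>carrier M. f (lact M a x)),
     lact = (\<lambda>b f. \<lambda>x\<in>carrier M. lact N b (f x))\<rparr>"


section \<open>The conditions on a trace map\<close>

definition R3 :: "('l, 'a, 'z) graded_scheme \<Rightarrow> ('a \<Rightarrow> 'a) \<Rightarrow> bool"
  where "R3 A tr \<longleftrightarrow>
    (\<forall>a\<in>carrier A. (\<forall>x\<in>carrier A. tr (a \<otimes>\<^bsub>A\<^esub> x) = \<zero>\<^bsub>A\<^esub>) \<longrightarrow> a = \<zero>\<^bsub>A\<^esub>)"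

text \<open>\<open>\<tau>\<close> is the inverse of the automorphism twisting the right action of \<open>B\<close> on \<open>A\<close>.\<close>

definition R4 ::
  "('l::ab_group_add, 'a, 'z) graded_scheme \<Rightarrow> 'a set \<Rightarrow> ('a \<Rightarrow> 'a) \<Rightarrow> ('a \<Rightarrow> 'a) \<Rightarrow> bool"
  where "R4 A B \<tau> tr \<longleftrightarrow>
    (\<forall>\<phi>\<in>carrier (HOMR (sub_ring A B) (twisted (\<lambda>a. a) A \<tau>) (regular (sub_ring A B))).
      \<exists>a\<in>carrier A. \<forall>x\<in>carrier A. \<phi> x = tr (a \<otimes>\<^bsub>A\<^esub> x))"

end

(*
  A homomorphism \<Psi> of right A-modules is determined by tr = \<Psi>(1), through
  \<Psi>(a)(x) = tr (\<alpha>\<inverse>(a) x).  Under this correspondence, left B-linearity of \<Psi>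
  and of tr agree, injectivity of \<Psi> is (R3) and surjectivity is (R4), because neither the shift of
  the target nor the left twist of the source changes the underlying set of HOM.  That tr has degree 0
  rests on 1 having degree 0; that \<Psi> preserves degrees rests on \<alpha>\<inverse> preserving them.
*)
theory Submission
  imports Defs
begin

section \<open>Graded groups and rings\<close>

text \<open>Induction on the index set. An infinite \<open>I\<close> is covered as well: both sums
  are then zero by convention, and \<open>f\<close> maps zero to zero.\<close>

lemma finsum_hom:
  assumes "abelian_group M" "abelian_group N"
    and f: "f \<in> hom (add_monoid M) (add_monoid N)"
    and "\<And>i. i \<in> I \<Longrightarrow> g i \<in> carrier M"
  shows "f (finsum M g I) = finsum N (\<lambda>i. f (g i)) I"
proof -
  interpret M: abelian_group M by fact
  interpret N: abelian_group N by fact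
  have closed: "f x \<in> carrier N" if "x \<in> carrier M" for x
    using f that by (auto simp: hom_def)
  have add: "f (x \<oplus>\<^bsub>M\<^esub> y) = f x \<oplus>\<^bsub>N\<^esub> f y" if "x \<in> carrier M" "y \<in> carrier M" for x y
    using f that by (auto simp: hom_def)
  have zero: "f \<zero>\<^bsub>M\<^esub> = \<zero>\<^bsub>N\<^esub>"
    using add[of "\<zero>\<^bsub>M\<^esub>" "\<zero>\<^bsub>M\<^esub>"] closed[of "\<zero>\<^bsub>M\<^esub>"] by simp
  show ?thesis
    using assms(4)
  proof (induction I rule: infinite_finite_induct)
    case (insert i I)
    then have "(\<lambda>i. g i) \<in> I \<rightarrow> carrier M" "(\<lambda>i. f (g i)) \<in> I \<rightarrow> carrier N"
      by (auto intro: closed)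
    with insert show ?case
      by (simp add: add closed)
  qed (simp_all add: zero)
qed

lemma hom_add_zero:
  assumes "abelian_group M" "abelian_group N" "f \<in> hom (add_monoid M) (add_monoid N)"
  shows "f \<zero>\<^bsub>M\<^esub> = \<zero>\<^bsub>N\<^esub>"
  using finsum_hom[OF assms, of "{}"] assms(1,2)
  by (simp add: abelian_group.axioms(1) abelian_monoid.finsum_empty)

section \<open>Homogeneous parts in a graded group\<close>

context graded_group
begin

lemma hcomp_carrier: "x \<in> hcomp M d \<Longrightarrow> x \<in> carrier M"
  using additive_subgroup.a_subset[OF hcomp_subgroup] by blast

lemma zero_hcomp: "\<zero> \<in> hcomp M d"
  by (rule additive_subgroup.zero_closed[OF hcomp_subgroup])

lemma hdecomp_hpart: "x \<in> carrier M \<Longrightarrow> hdecomp M x (hpart M x)"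
  unfolding hpart_def by (rule theI'[OF hdecomp_unique])

lemma hpart_hcomp: "x \<in> carrier M \<Longrightarrow> hpart M x d \<in> hcomp M d"
  using hdecomp_hpart[of x] unfolding hdecomp_def by blast

lemma finite_hpart: "x \<in> carrier M \<Longrightarrow> finite {d. hpart M x d \<noteq> \<zero>}"
  using hdecomp_hpart by (auto simp: hdecomp_def)

lemma finsum_hpart: "x \<in> carrier M \<Longrightarrow> (\<Oplus>d\<in>{d. hpart M x d \<noteq> \<zero>}. hpart M x d) = x"
  using hdecomp_hpart by (auto simp: hdecomp_def)

text \<open>Uniqueness of decompositions: \<open>c\<close> extended by zero outside \<open>D\<close>
  decomposes the sum, hence is its family of parts. Comparing components of a given degree rests on
  this.\<close>

lemma hpart_finsum:
  assumes "finite D" and c: "\<And>d. d \<in> D \<Longrightarrow> c d \<in> hcomp M d"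
  shows "hpart M (\<Oplus>d\<in>D. c d) = (\<lambda>d. if d \<in> D then c d else \<zero>)"
proof -
  let ?c = "\<lambda>d. if d \<in> D then c d else \<zero>"
  have carr: "c d \<in> carrier M" if "d \<in> D" for d
    using c hcomp_carrier that by blast
  have "(\<Oplus>d\<in>D. c d) = (\<Oplus>d\<in>{d. ?c d \<noteq> \<zero>}. ?c d)"
    by (rule add.finprod_mono_neutral_cong_right) (use assms(1) carr in auto)
  then have "hdecomp M (\<Oplus>d\<in>D. c d) ?c"
    using assms zero_hcomp by (auto simp: hdecomp_def intro: finite_subset[OF _ assms(1)])
  then show ?thesis
    unfolding hpart_def using carr by (intro the1_equality hdecomp_unique finsum_closed) auto
qed

lemma hpart_homogeneous:
  assumes "x \<in> hcomp M d"
  shows "hpart M x = (\<lambda>e. if e = d then x else \<zero>)"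
  using hpart_finsum[of "{d}" "\<lambda>_. x"] assms hcomp_carrier[OF assms] by simp

end

section \<open>Degrees of the unit and of preimages under automorphisms\<close>

context graded_superring
begin

text \<open>Let \<open>e\<close> be the degree 0 part of 1. For x of degree d, comparing the
  components of degree d in x = x 1 gives x = x \<open>e\<close>. Summing this over the homogeneous
  parts of 1 yields 1 = 1 \<open>e\<close> = \<open>e\<close>.\<close>

lemma one_hcomp: "\<one> \<in> hcomp A 0"
proof -
  let ?e = "hpart A \<one>" and ?D = "{d. hpart A \<one> d \<noteq> \<zero>}"
  have e: "?e d \<in> hcomp A d" "?e d \<in> carrier A" for d
    using hpart_hcomp hcomp_carrier by blast+
  have homogeneous: "x \<otimes> ?e 0 = x" if x: "x \<in> hcomp A d" for x d
  proof -
    have xc: "x \<in> carrier A"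
      using x hcomp_carrier by blast
    \<comment> \<open>The product of x with the part of 1 of degree i has degree d + i. Indexing by
      this total degree gives a sum to which \<open>hpart_finsum\<close> applies.\<close>
    let ?S = "(+) d ` ?D"
    have "x = x \<otimes> (\<Oplus>i\<in>?D. ?e i)"
      using xc by (simp add: finsum_hpart)
    also have "\<dots> = (\<Oplus>i\<in>?D. x \<otimes> ?e i)"
      by (rule finsum_rdistr) (use xc e finite_hpart in auto)
    also have "\<dots> = (\<Oplus>i\<in>?S. x \<otimes> ?e (i - d))"
      by (subst finsum_reindex) (use xc e in \<open>auto simp: inj_on_def\<close>)
    finally have sum: "x = (\<Oplus>i\<in>?S. x \<otimes> ?e (i - d))" .
    have "hpart A (\<Oplus>i\<in>?S. x \<otimes> ?e (i - d)) = (\<lambda>i. if i \<in> ?S then x \<otimes> ?e (i - d) else \<zero>)"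
    proof (rule hpart_finsum)
      show "finite ?S"
        using finite_hpart by simp
      show "x \<otimes> ?e (i - d) \<in> hcomp A i" for i
        using hcomp_mult[OF x e(1)[of "i - d"]] by simp
    qed
    from fun_cong[OF this[folded sum], of d]
    have "hpart A x d = (if d \<in> ?S then x \<otimes> ?e (d - d) else \<zero>)" .
    moreover have "hpart A x d = x"
      using hpart_homogeneous[OF x] by simp
    \<comment> \<open>If the degree 0 part of 1 is zero, then d lies outside \<open>?S\<close> and x
      = 0, so the equation still holds.\<close>
    ultimately show ?thesis
      using xc by (cases "?e 0 = \<zero>") (auto simp: image_iff split: if_splits)
  qed
  have "\<one> = (\<Oplus>i\<in>?D. ?e i)"
    by (simp add: finsum_hpart)
  also have "\<dots> = (\<Oplus>i\<in>?D. ?e i \<otimes> ?e 0)"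
    using homogeneous[OF e(1)] e(2) by (intro finsum_cong') simp_all
  also have "\<dots> = (\<Oplus>i\<in>?D. ?e i) \<otimes> ?e 0"
    by (rule finsum_ldistr[symmetric]) (use e finite_hpart in auto)
  also have "\<dots> = ?e 0"
    using e by (simp add: finsum_hpart)
  finally have "?e 0 = \<one>"
    by (rule sym)
  then show ?thesis
    using e(1)[of 0] by simp
qed

text \<open>\<open>graded_aut\<close> asks only the forward map to preserve degrees. Applying
  \<open>h\<close> to the parts of the preimage y decomposes x, which has no part outside degree d.
  So \<open>h\<close> sends the degree d part of y to x, and injectivity makes that part equal to
  y.\<close>

lemma graded_aut_inv_hcomp:
  assumes h: "h \<in> graded_aut A" and x: "x \<in> hcomp A d"
  shows "inv_into (carrier A) h x \<in> hcomp A d"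
proof -
  have hom: "h \<in> hom (add_monoid A) (add_monoid A)"
    and bij: "bij_betw h (carrier A) (carrier A)"
    and deg: "\<And>e y. y \<in> hcomp A e \<Longrightarrow> h y \<in> hcomp A e"
    using h by (auto simp: graded_aut_def ring_iso_def ring_hom_def hom_def)
  define y where "y = inv_into (carrier A) h x"
  have xc: "x \<in> carrier A"
    using x hcomp_carrier by blast
  have y: "y \<in> carrier A" and hy: "h y = x"
    using bij xc by (auto simp: y_def bij_betw_def inv_into_into f_inv_into_f)
  let ?D = "{e. hpart A y e \<noteq> \<zero>}"
  have c: "hpart A y e \<in> carrier A" for e
    using y hpart_hcomp hcomp_carrier by blast
  have "x = h (\<Oplus>e\<in>?D. hpart A y e)"
    using y hy by (simp add: finsum_hpart)
  also have "\<dots> = (\<Oplus>e\<in>?D. h (hpart A y e))"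
    by (rule finsum_hom[OF abelian_group_axioms abelian_group_axioms hom c])
  finally have sum: "x = (\<Oplus>e\<in>?D. h (hpart A y e))" .
  have "hpart A (\<Oplus>e\<in>?D. h (hpart A y e)) = (\<lambda>e. if e \<in> ?D then h (hpart A y e) else \<zero>)"
    by (rule hpart_finsum) (use y in \<open>simp_all add: finite_hpart deg hpart_hcomp\<close>)
  from fun_cong[OF this[folded sum], of d]
  have part: "x = (if d \<in> ?D then h (hpart A y d) else \<zero>)"
    by (simp add: hpart_homogeneous[OF x])
  have zero: "h \<zero> = \<zero>"
    by (rule hom_add_zero[OF abelian_group_axioms abelian_group_axioms hom])
  \<comment> \<open>For d outside \<open>?D\<close>, both x and the degree d part of y are
    zero.\<close>
  have "h (hpart A y d) = x"
    using part zero by (auto split: if_splits)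
  then have "hpart A y d = y"
    using hy y c bij by (auto simp: bij_betw_def inj_on_def)
  then show ?thesis
    using hpart_hcomp[OF y, of d] by (simp add: y_def)
qed

end

section \<open>HOM groups and shifts\<close>

lemma carrier_HOMRI:
  assumes "finite D" "\<And>d. d \<in> D \<Longrightarrow> F d \<in> HOMR_comp S M N d"
  shows "(\<lambda>x\<in>carrier M. \<Oplus>\<^bsub>N\<^esub>d\<in>D. F d x) \<in> carrier (HOMR S M N)"
  unfolding HOMR_def by (simp, intro exI[of _ D] exI[of _ F]) (use assms in blast)

text \<open>Elements of \<open>HOMR\<close> are finite sums indexed by degree, so moving every
  degree by \<open>s\<close> only renames the summands. For a shift, \<open>s\<close> is the
  shifting degree in one direction and its negative in the other.\<close>

lemma carrier_HOMR_reindex: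
  assumes "abelian_group N" "add_monoid N' = add_monoid N"
    and comp: "\<And>d. HOMR_comp S M N d \<subseteq> HOMR_comp S M N' (d + s)"
  shows "carrier (HOMR S M N) \<subseteq> carrier (HOMR S M N')"
proof
  interpret N: abelian_group N by fact
  fix f assume "f \<in> carrier (HOMR S M N)"
  then obtain D F where f: "f = (\<lambda>x\<in>carrier M. \<Oplus>\<^bsub>N\<^esub>d\<in>D. F d x)" and "finite D"
    and F: "\<And>d. d \<in> D \<Longrightarrow> F d \<in> HOMR_comp S M N d"
    by (auto simp: HOMR_def)
  define E where "E = (\<lambda>d. d + s) ` D"
  have "(\<Oplus>\<^bsub>N\<^esub>d\<in>D. F d x) = (\<Oplus>\<^bsub>N'\<^esub>d\<in>E. F (d - s) x)" if "x \<in> carrier M" for x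
  proof -
    have "F d x \<in> carrier N" if "d \<in> D" for d
      using F[OF that] \<open>x \<in> carrier M\<close> by (auto simp: HOMR_comp_def hom_def)
    then have "(\<Oplus>\<^bsub>N\<^esub>d\<in>E. F (d - s) x) = (\<Oplus>\<^bsub>N\<^esub>d\<in>D. F d x)"
      unfolding E_def by (subst N.finsum_reindex) (auto simp: inj_on_def)
    then show ?thesis
      using assms(2) by (simp add: finsum_def)
  qed
  then have "f = (\<lambda>x\<in>carrier M. \<Oplus>\<^bsub>N'\<^esub>d\<in>E. F (d - s) x)"
    unfolding f by (intro restrict_ext) auto
  moreover have "finite E"
    using \<open>finite D\<close> by (simp add: E_def)
  moreover have "F (d - s) \<in> HOMR_comp S M N' d" if "d \<in> E" for d
    using that F comp by (fastforce simp: E_def)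
  ultimately show "f \<in> carrier (HOMR S M N')"
    by (simp only: carrier_HOMRI)
qed

lemma add_monoid_shift: "add_monoid (shift R \<mu> \<gamma> N) = add_monoid N"
  by (simp add: shift_def)

text \<open>Addition and subtraction agree in \<open>bit\<close>, so the two signs in
  \<open>shift\<close> amount to one subtraction in the grading group.\<close>

lemma hcomp_shift: "hcomp (shift R \<mu> \<gamma> N) d = hcomp N (d - (\<mu>, \<gamma>))"
  by (cases d) (simp add: shift_def)

lemma HOMR_comp_shift: "HOMR_comp S M (shift R \<mu> \<gamma> N) d = HOMR_comp S M N (d - (\<mu>, \<gamma>))"
  by (simp add: HOMR_comp_def add_monoid_shift hcomp_shift add_diff_eq)
     (simp add: shift_def)

lemma carrier_HOMR_shift:
  assumes "abelian_group N"
  shows "carrier (HOMR S M (shift R \<mu> \<gamma> N)) = carrier (HOMR S M N)"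
proof
  have "abelian_group (shift R \<mu> \<gamma> N)"
    using assms by (simp add: abelian_group_def abelian_group_axioms_def abelian_monoid_def shift_def)
  then show "carrier (HOMR S M (shift R \<mu> \<gamma> N)) \<subseteq> carrier (HOMR S M N)"
    by (rule carrier_HOMR_reindex[where s = "- (\<mu>, \<gamma>)"])
       (simp_all only: add_monoid_shift HOMR_comp_shift diff_conv_add_uminus order_refl)
  show "carrier (HOMR S M N) \<subseteq> carrier (HOMR S M (shift R \<mu> \<gamma> N))"
    by (rule carrier_HOMR_reindex[where s = "(\<mu>, \<gamma>)", OF assms])
       (simp_all only: add_monoid_shift HOMR_comp_shift add_diff_cancel_right' order_refl)
qed

lemma carrier_HOMR_twisted_left:
  "carrier (HOMR S (twisted \<sigma> A \<tau>) N) = carrier (HOMR S (twisted \<sigma>' A \<tau>) N)"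
  by (simp add: HOMR_def HOMR_comp_def twisted_def)

section \<open>Trace maps\<close>

locale twisted_extension = graded_superring A
  for A :: "('l::ab_group_add, 'a, 'z) graded_scheme" (structure) +
  fixes B :: "'a set" and \<alpha> \<beta> :: "'a \<Rightarrow> 'a" and \<mu> :: 'l and \<pi> :: bit
  assumes subring: "graded_subring B A"
    and aut: "\<alpha> \<in> graded_aut A"
    and aut_sub: "\<beta> \<in> graded_aut (sub_ring A B)"
begin

abbreviation "R \<equiv> sub_ring A B"
abbreviation "\<alpha>' \<equiv> inv_into (carrier A) \<alpha>"
abbreviation "\<beta>' \<equiv> inv_into B \<beta>"
abbreviation "M \<equiv> twisted \<alpha>' A \<beta>'"
abbreviation "N \<equiv> shift R \<mu> \<pi> (regular R)"

section \<open>Source, target and regular modules expressed through A\<close>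

lemma carrier_M [simp]: "carrier M = carrier A"
  and add_M [simp]: "add M = add A"
  and hcomp_M [simp]: "hcomp M = hcomp A"
  and ract_M [simp]: "ract M x a = x \<otimes> \<beta>' a"
  and lact_M [simp]: "lact M a x = \<alpha>' a \<otimes> x"
  by (simp_all add: twisted_def)

text \<open>The left action of \<open>N\<close> stays folded: left B-linearity of the trace and of
  \<Psi> both refer to the same term \<open>lact N b\<close>, so the sign of the shift need not be
  evaluated.\<close>

lemma carrier_N [simp]: "carrier N = B"
  and add_N [simp]: "add N = add A"
  and zero_N [simp]: "zero N = \<zero>"
  and ract_N [simp]: "ract N x b = x \<otimes> b"
  by (simp_all add: shift_def regular_def twisted_def sub_ring_def)

lemma carrier_R [simp]: "carrier R = B"
  by (simp add: sub_ring_def)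

lemma carrier_regular [simp]: "carrier (regular A) = carrier A"
  and add_regular [simp]: "add (regular A) = add A"
  and hcomp_regular [simp]: "hcomp (regular A) = hcomp A"
  and ract_regular [simp]: "ract (regular A) x a = x \<otimes> a"
  and lact_regular [simp]: "lact (regular A) a x = a \<otimes> x"
  by (simp_all add: regular_def twisted_def)

lemma B_carrier: "b \<in> B \<Longrightarrow> b \<in> carrier A"
  using subring subringE(1) by (fastforce simp: graded_subring_def)

lemma abelian_group_regular: "abelian_group (regular R)"
proof (rule abelian_groupI)
  have B: "subring B A"
    using subring by (simp add: graded_subring_def)
  show "\<exists>y\<in>carrier (regular R). y \<oplus>\<^bsub>regular R\<^esub> x = \<zero>\<^bsub>regular R\<^esub>"
    if "x \<in> carrier (regular R)" for x
    using that subringE(5)[OF B, of x] B_carrier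
    by (auto simp: regular_def twisted_def sub_ring_def l_neg intro!: bexI[of _ "\<ominus> x"])
qed (use subring B_carrier in \<open>auto simp: regular_def twisted_def sub_ring_def graded_subring_def
      subringE a_ac\<close>)

lemma abelian_group_N: "abelian_group N"
  using abelian_group_regular
  by (simp add: abelian_group_def abelian_group_axioms_def abelian_monoid_def shift_def)

lemma alpha_inv_closed [simp]: "a \<in> carrier A \<Longrightarrow> \<alpha>' a \<in> carrier A"
  and alpha_alpha_inv [simp]: "a \<in> carrier A \<Longrightarrow> \<alpha> (\<alpha>' a) = a"
  and alpha_inv_alpha [simp]: "a \<in> carrier A \<Longrightarrow> \<alpha>' (\<alpha> a) = a"
  and alpha_closed [simp]: "a \<in> carrier A \<Longrightarrow> \<alpha> a \<in> carrier A"
  using aut by (auto simp: graded_aut_def ring_iso_def bij_betw_def inv_into_into f_inv_into_f)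

lemma alpha_inv_ring_iso: "\<alpha>' \<in> ring_iso A A"
  using aut ring_iso_set_sym[OF ring_axioms] by (auto simp: graded_aut_def)

lemma alpha_inv_mult [simp]:
  "\<lbrakk>a \<in> carrier A; b \<in> carrier A\<rbrakk> \<Longrightarrow> \<alpha>' (a \<otimes> b) = \<alpha>' a \<otimes> \<alpha>' b"
  and alpha_inv_add [simp]:
  "\<lbrakk>a \<in> carrier A; b \<in> carrier A\<rbrakk> \<Longrightarrow> \<alpha>' (a \<oplus> b) = \<alpha>' a \<oplus> \<alpha>' b"
  and alpha_inv_one [simp]: "\<alpha>' \<one> = \<one>"
  using alpha_inv_ring_iso by (auto simp: ring_iso_def ring_hom_def)

lemma beta_inv_carrier [simp]: "b \<in> B \<Longrightarrow> \<beta>' b \<in> carrier A"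
  using aut_sub by (auto simp: graded_aut_def ring_iso_def bij_betw_def inv_into_into B_carrier)

text \<open>Restates \<open>R4\<close> over the HOM group in which \<Psi> takes its values, where it
  can be matched with surjectivity of \<Psi>.\<close>

lemma R4_iff:
  "R4 A B \<beta>' tr \<longleftrightarrow>
    (\<forall>\<phi>\<in>carrier (HOMR R M N). \<exists>a\<in>carrier A. \<forall>x\<in>carrier A. \<phi> x = tr (a \<otimes> x))"
  unfolding R4_def carrier_HOMR_shift[OF abelian_group_regular]
    carrier_HOMR_twisted_left[of R \<alpha>' A \<beta>' _ "\<lambda>a. a"] ..

lemma HOMR_bimodule_simps [simp]:
  "carrier (HOMR_bimodule R M N) = carrier (HOMR R M N)"
  "add (HOMR_bimodule R M N) = (\<lambda>f g. \<lambda>x\<in>carrier A. f x \<oplus> g x)"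
  "hcomp (HOMR_bimodule R M N) = HOMR_comp R M N"
  "ract (HOMR_bimodule R M N) f a = (\<lambda>x\<in>carrier A. f (\<alpha>' a \<otimes> x))"
  "lact (HOMR_bimodule R M N) b f = (\<lambda>x\<in>carrier A. lact N b (f x))"
  by (simp_all add: HOMR_bimodule_def HOMR_def del: carrier_N)

lemma bimodule_homD:
  assumes "tr \<in> bimodule_hom R R M N"
  shows "tr \<in> hom (add_monoid A) (add_monoid N)"
    and "x \<in> carrier A \<Longrightarrow> tr x \<in> B"
    and "\<lbrakk>x \<in> carrier A; y \<in> carrier A\<rbrakk> \<Longrightarrow> tr (x \<oplus> y) = tr x \<oplus> tr y"
    and "x \<in> hcomp A d \<Longrightarrow> tr x \<in> hcomp N d"
    and "\<lbrakk>b \<in> B; x \<in> carrier A\<rbrakk> \<Longrightarrow> tr (\<alpha>' b \<otimes> x) = lact N b (tr x)"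
    and "\<lbrakk>b \<in> B; x \<in> carrier A\<rbrakk> \<Longrightarrow> tr (x \<otimes> \<beta>' b) = tr x \<otimes> b"
  using assms by (auto simp: bimodule_hom_def hom_def Pi_iff simp del: split_paired_All)

lemma bimodule_hom_zero:
  assumes "tr \<in> bimodule_hom R R M N"
  shows "tr \<zero> = \<zero>"
  using hom_add_zero[OF abelian_group_axioms abelian_group_N bimodule_homD(1)[OF assms]] by simp

section \<open>The correspondence between isomorphisms and trace maps\<close>

lemma trace_of_bimodule_iso:
  assumes "\<Psi> \<in> bimodule_iso R A (regular A) (HOMR_bimodule R M N)"
  shows "\<Psi> \<one> \<in> bimodule_hom R R M N" "R3 A (\<Psi> \<one>)" "R4 A B \<beta>' (\<Psi> \<one>)"
proof -
  have deg: "\<And>d x. x \<in> hcomp A d \<Longrightarrow> \<Psi> x \<in> HOMR_comp R M N d"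
    and lact: "\<And>b x. b \<in> B \<Longrightarrow> x \<in> carrier A \<Longrightarrow> \<Psi> (b \<otimes> x) = (\<lambda>y\<in>carrier A. lact N b (\<Psi> x y))"
    and ract: "\<And>a x. a \<in> carrier A \<Longrightarrow> x \<in> carrier A \<Longrightarrow>
      \<Psi> (x \<otimes> a) = (\<lambda>y\<in>carrier A. \<Psi> x (\<alpha>' a \<otimes> y))"
    and inj: "inj_on \<Psi> (carrier A)" and surj: "\<Psi> ` carrier A = carrier (HOMR R M N)"
    using assms by (auto simp: bimodule_iso_def bimodule_hom_def bij_betw_def)
  \<comment> \<open>Right A-linearity applied to a = 1 a.\<close>
  have Psi: "\<Psi> a x = \<Psi> \<one> (\<alpha>' a \<otimes> x)" if "a \<in> carrier A" "x \<in> carrier A" for a x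
    using ract[of a \<one>] that by simp
  have "\<Psi> \<one> \<in> HOMR_comp R M N 0"
    by (rule deg[OF one_hcomp])
  \<comment> \<open>Two evaluations of \<Psi>(b): from b = 1 b by right A-linearity and from b = b 1
    by left B-linearity.\<close>
  moreover have "\<Psi> \<one> (\<alpha>' b \<otimes> x) = lact N b (\<Psi> \<one> x)" if "b \<in> B" "x \<in> carrier A" for b x
    using Psi[of b x] lact[of b \<one>] that B_carrier by simp
  ultimately show tr: "\<Psi> \<one> \<in> bimodule_hom R R M N"
    by (auto simp: HOMR_comp_def bimodule_hom_def)
  show "R3 A (\<Psi> \<one>)"
    unfolding R3_def
  proof (intro ballI impI)
    fix a assume a: "a \<in> carrier A" and ann: "\<forall>x\<in>carrier A. \<Psi> \<one> (a \<otimes> x) = \<zero>"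
    \<comment> \<open>The argument is \<alpha>(a) because \<Psi>(\<alpha>(a))(x) = tr(a x). The same
      computation with a = 0 supplies a second preimage of the zero map, to which injectivity is
      applied.\<close>
    have "\<Psi> (\<alpha> a) = (\<lambda>x\<in>carrier A. \<zero>)"
      using ract[of "\<alpha> a" \<one>] a ann by (auto intro!: restrict_ext)
    moreover have "\<Psi> (\<alpha> \<zero>) = (\<lambda>x\<in>carrier A. \<zero>)"
      using ract[of "\<alpha> \<zero>" \<one>] bimodule_hom_zero[OF tr] by (auto intro!: restrict_ext)
    ultimately have "\<alpha> a = \<alpha> \<zero>"
      using inj a by (auto simp: inj_on_def)
    then show "a = \<zero>"
      using alpha_inv_alpha a zero_closed by metis
  qed
  show "R4 A B \<beta>' (\<Psi> \<one>)"
    unfolding R4_iff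
  proof
    fix \<phi> assume "\<phi> \<in> carrier (HOMR R M N)"
    then obtain a where "a \<in> carrier A" "\<phi> = \<Psi> a"
      using surj by blast
    \<comment> \<open>For \<phi> = \<Psi>(a) the witness is \<open>\<alpha>' a\<close>.\<close>
    then show "\<exists>a\<in>carrier A. \<forall>x\<in>carrier A. \<phi> x = \<Psi> \<one> (a \<otimes> x)"
      using Psi alpha_inv_closed by blast
  qed
qed

lemma bimodule_iso_of_trace:
  assumes tr: "tr \<in> bimodule_hom R R M N" and "R3 A tr" "R4 A B \<beta>' tr"
  defines "\<Psi> \<equiv> \<lambda>a. \<lambda>x\<in>carrier A. tr (\<alpha>' a \<otimes> x)"
  shows "\<Psi> \<in> bimodule_iso R A (regular A) (HOMR_bimodule R M N)"
proof -
  note trD = bimodule_homD[OF tr]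
  \<comment> \<open>\<open>\<alpha>' a\<close> has the degree d of a, and \<open>tr\<close> has
    degree 0 into the shifted module, so x of degree e is sent to degree e + d of
    \<open>N\<close>.\<close>
  have comp: "\<Psi> a \<in> HOMR_comp R M N d" if a: "a \<in> hcomp A d" for a d
  proof -
    have ac: "a \<in> carrier A"
      using a hcomp_carrier by blast
    have "\<Psi> a x \<in> hcomp N (e + d)" if "x \<in> hcomp A e" for e x
      using trD(4)[OF hcomp_mult[OF graded_aut_inv_hcomp[OF aut a] that]] hcomp_carrier[OF that]
      by (simp add: \<Psi>_def add.commute)
    moreover have "\<Psi> a (x \<otimes> \<beta>' b) = \<Psi> a x \<otimes> b" if "x \<in> carrier A" "b \<in> B" for x b
      using that ac trD(6)[of b "\<alpha>' a \<otimes> x"] by (simp add: \<Psi>_def m_assoc)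
    ultimately show ?thesis
      using ac trD(2,3) by (auto simp: HOMR_comp_def \<Psi>_def hom_def r_distr)
  qed
  \<comment> \<open>Membership in \<open>HOMR\<close> requires a finite sum of homogeneous maps. For
    fixed x the map c to \<Psi>(c)(x) is additive, so decomposing a into homogeneous parts provides
    one.\<close>
  have closed: "\<Psi> a \<in> carrier (HOMR R M N)" if a: "a \<in> carrier A" for a
  proof -
    let ?D = "{d. hpart A a d \<noteq> \<zero>}"
    have part: "hpart A a d \<in> carrier A" for d
      using a hpart_hcomp hcomp_carrier by blast
    have "\<Psi> a x = (\<Oplus>\<^bsub>N\<^esub>d\<in>?D. \<Psi> (hpart A a d) x)" if x: "x \<in> carrier A" for x
    proof -
      have "(\<lambda>c. \<Psi> c x) \<in> hom (add_monoid A) (add_monoid N)"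
        using x trD(2,3) by (auto simp: \<Psi>_def hom_def l_distr)
      from finsum_hom[OF abelian_group_axioms abelian_group_N this, of ?D "hpart A a"]
      show ?thesis
        using a part by (simp add: finsum_hpart)
    qed
    then have "\<Psi> a = (\<lambda>x\<in>carrier M. \<Oplus>\<^bsub>N\<^esub>d\<in>?D. \<Psi> (hpart A a d) x)"
      by (auto simp: \<Psi>_def fun_eq_iff restrict_def)
    moreover have "(\<lambda>x\<in>carrier M. \<Oplus>\<^bsub>N\<^esub>d\<in>?D. \<Psi> (hpart A a d) x) \<in> carrier (HOMR R M N)"
      using comp[OF hpart_hcomp[OF a]] by (intro carrier_HOMRI finite_hpart a)
    ultimately show ?thesis
      by simp
  qed
  have add: "\<Psi> (a \<oplus> b) = (\<lambda>x\<in>carrier A. \<Psi> a x \<oplus> \<Psi> b x)"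
    if "a \<in> carrier A" "b \<in> carrier A" for a b
    using that trD(3) by (auto simp: \<Psi>_def l_distr intro!: restrict_ext)
  \<comment> \<open>B acts on the left of \<open>M\<close> through \<open>\<alpha>'\<close>, so
    linearity of \<open>tr\<close> moves b out of tr(\<open>\<alpha>' b\<close>
    \<open>\<alpha>' a\<close> x).\<close>
  have lact: "\<Psi> (b \<otimes> a) = (\<lambda>x\<in>carrier A. lact N b (\<Psi> a x))"
    if "b \<in> B" "a \<in> carrier A" for a b
    using that trD(5) B_carrier by (auto simp: \<Psi>_def m_assoc intro!: restrict_ext)
  have ract: "\<Psi> (a \<otimes> b) = (\<lambda>x\<in>carrier A. \<Psi> a (\<alpha>' b \<otimes> x))"
    if "a \<in> carrier A" "b \<in> carrier A" for a b
    using that by (auto simp: \<Psi>_def m_assoc intro!: restrict_ext)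
  have hom: "\<Psi> \<in> bimodule_hom R A (regular A) (HOMR_bimodule R M N)"
    using closed comp add lact ract by (auto simp: bimodule_hom_def hom_def)
  have "inj_on \<Psi> (carrier A)"
  proof (rule inj_onI)
    fix a b assume ab: "a \<in> carrier A" "b \<in> carrier A" and eq: "\<Psi> a = \<Psi> b"
    \<comment> \<open>Equality of \<Psi>(a) and \<Psi>(b) makes \<open>tr\<close> vanish on the
      right ideal generated by \<open>\<alpha>' a \<ominus> \<alpha>' b\<close>, as (R3) requires.
      Writing \<open>\<alpha>' a \<otimes> x\<close> as a sum reduces the claim to additivity and
      cancellation.\<close>
    have "tr ((\<alpha>' a \<ominus> \<alpha>' b) \<otimes> x) = \<zero>" if x: "x \<in> carrier A" for x
    proof -
      let ?c = "\<alpha>' a \<ominus> \<alpha>' b"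
      have "\<alpha>' a \<otimes> x = ?c \<otimes> x \<oplus> \<alpha>' b \<otimes> x"
        using ab x by (simp add: l_distr[symmetric] minus_eq a_assoc l_neg)
      then have "tr (\<alpha>' a \<otimes> x) = tr (?c \<otimes> x) \<oplus> tr (\<alpha>' b \<otimes> x)"
        using trD(3) ab x by simp
      moreover have "tr (\<alpha>' a \<otimes> x) = tr (\<alpha>' b \<otimes> x)"
        using fun_cong[OF eq, of x] x by (simp add: \<Psi>_def)
      ultimately show ?thesis
        using trD(2) B_carrier ab x by simp
    qed
    then have "\<alpha>' a \<ominus> \<alpha>' b = \<zero>"
      using \<open>R3 A tr\<close> ab by (simp add: R3_def)
    then have "\<alpha>' a = \<alpha>' b"
      using ab by simp
    then show "a = b"
      using ab alpha_alpha_inv by metis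
  qed
  moreover have "carrier (HOMR R M N) \<subseteq> \<Psi> ` carrier A"
  proof
    fix \<phi> assume \<phi>: "\<phi> \<in> carrier (HOMR R M N)"
    then obtain a where a: "a \<in> carrier A" "\<forall>x\<in>carrier A. \<phi> x = tr (a \<otimes> x)"
      using \<open>R4 A B \<beta>' tr\<close> unfolding R4_iff by blast
    \<comment> \<open>(R4) gives equality only on A; extensionality of both maps turns it into
      equality of functions. The preimage is \<alpha>(a), since \<open>\<alpha>'\<close> returns it
      to a.\<close>
    have "\<phi> \<in> extensional (carrier A)"
      using \<phi> by (auto simp: HOMR_def)
    then have "\<phi> = \<Psi> (\<alpha> a)"
      using a by (auto simp: \<Psi>_def intro: extensionalityI)
    moreover have "\<alpha> a \<in> carrier A"
      using a by simp
    ultimately show "\<phi> \<in> \<Psi> ` carrier A"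
      by (rule image_eqI)
  qed
  ultimately show ?thesis
    using hom closed by (auto simp: bimodule_iso_def bij_betw_def)
qed

end

theorem proposition4p3:
  fixes A :: "('l::ab_group_add, 'a, 'z) graded_scheme"
    and B :: "'a set"
    and \<alpha> \<beta> :: "'a \<Rightarrow> 'a"
    and \<mu> :: 'l
    and \<pi> :: bit
  assumes "graded_superring A"
    and "graded_subring B A"
    and "\<alpha> \<in> graded_aut A"
    and "\<beta> \<in> graded_aut (sub_ring A B)"
  shows
    "let R = sub_ring A B;
         \<alpha>' = inv_into (carrier A) \<alpha>;
         \<beta>' = inv_into B \<beta>;
         M = twisted \<alpha>' A \<beta>';
         N = shift R \<mu> \<pi> (regular R)
     in (\<forall>\<Psi>\<in>bimodule_iso R A (regular A) (HOMR_bimodule R M N).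
           \<Psi> \<one>\<^bsub>A\<^esub> \<in> bimodule_hom R R M N \<and> R3 A (\<Psi> \<one>\<^bsub>A\<^esub>) \<and> R4 A B \<beta>' (\<Psi> \<one>\<^bsub>A\<^esub>)) \<and>
        (\<forall>tr\<in>bimodule_hom R R M N. R3 A tr \<and> R4 A B \<beta>' tr \<longrightarrow>
           (\<exists>\<Psi>\<in>bimodule_iso R A (regular A) (HOMR_bimodule R M N).
              \<forall>x\<in>carrier A. tr x = \<Psi> \<one>\<^bsub>A\<^esub> x))"
proof -
  interpret twisted_extension A B \<alpha> \<beta> \<mu> \<pi>
    using assms by (simp add: twisted_extension_def twisted_extension_axioms_def)
  \<comment> \<open>Since \<open>\<alpha>'\<close> fixes 1, \<Psi>(1) agrees with \<open>tr\<close>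
    on A. Outside A, \<Psi>(1) is \<open>undefined\<close> while \<open>tr\<close> is arbitrary,
    hence the pointwise equation.\<close>
  have "\<exists>\<Psi>\<in>bimodule_iso R A (regular A) (HOMR_bimodule R M N). \<forall>x\<in>carrier A. tr x = \<Psi> \<one>\<^bsub>A\<^esub> x"
    if "tr \<in> bimodule_hom R R M N" "R3 A tr" "R4 A B \<beta>' tr" for tr
    using bimodule_iso_of_trace[OF that] by (rule rev_bexI) simp
  then show ?thesis
    unfolding Let_def using trace_of_bimodule_iso by blast
qed

end
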